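(* Let $n\ge 3$. The $n$-compartment cycle model with input, output, and leak in compartment $1$ only is generically locally identifiable, and the equation of its singular locus (up to sign) is $$a_{32}a_{43}\cdots a_{n,n-1}a_{1,n}\prod_{2\le i<j\le n}\left(a_{i+1,i}-a_{j+1,j}\right),$$ where $a_{n+1,n}:=a_{1,n}$.
   Context: A linear compartmental model $(G,In,Out,Leak)$ consists of a finite directed graph $G=(V,E)$ with $V=\{1,\dots,n\}$ and subsets $In,Out,Leak\subseteq V$. Each edge $i\to j$ carries a parameter $a_{ji}$ and each leak $i\in Leak$ a parameter $a_{0i}$ (independent real variables). The compartmental matrix is the $n\times n$ matrix $A$ with $A_{ij}=a_{ij}$ if $i\ne j$ and $j\to i$ is an edge, $A_{ij}=0$ if $i\ne j$ and $j\to i$ is not an edge, and $A_{ii}=-\sum_{k:\,i\to k\in E}a_{ki}$, with an additional summand $-a_{0i}$ if $i\in Leak$. The $n$-compartment cycle model has edges $1\to2\to3\to\cdots\to n\to1$ (parameters $a_{21},a_{32},\dots,a_{n,n-1},a_{1,n}$), no other edges, and $In=Out=Leak=\{1\}$ (leak parameter $a_{01}$); it has $n+1$ parameters. For $In=Out=\{1\}$, write $\det(\lambda I-A)=\lambda^n+c_{n-1}\lambda^{n-1}+\dots+c_0$ and $\det((\lambda I-A)_{11})=\lambda^{n-1}+d_{n-2}\lambda^{n-2}+\dots+d_0$, where $(\cdot)_{11}$ means removing row 1 and column 1. The coefficient map is the polynomial map $c=(c_0,\dots,c_{n-1},d_0,\dots,d_{n-2}):\mathbb{R}^{|E|+|Leak|}\to\mathbb{R}^{k}$,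 $k=2n-1$. The model is generically locally identifiable if, outside a set of measure zero, every point of $\mathbb{R}^{|E|+|Leak|}$ has an open neighborhood on which $c$ is one-to-one. Equation of the singular locus of a generically locally identifiable model with $|E|+|Leak|<k$ (the case here): if there is a choice of $|E|+|Leak|$ of the coefficients of $c$, with resulting restricted coefficient map $r:\mathbb{R}^{|E|+|Leak|}\to\mathbb{R}^{|E|+|Leak|}$, such that at every parameter point $\det(\mathrm{Jac}(r))=0$ if and only if the Jacobian matrix of $c$ has rank strictly less than $|E|+|Leak|$, then $\det(\mathrm{Jac}(r))$ is the equation of the singular locus (up to sign). So the claim that a polynomial $f$ is the equation of the singular locus means that such a choice $r$ exists with $\det(\mathrm{Jac}(r))=\pm f$. *)

theory Defs
  imports
    "HOL-Analysis.Function_Topology"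
    "HOL-Analysis.Lebesgue_Measure"
    "HOL-Analysis.Finite_Product_Measure"
    "HOL-Analysis.Derivative"
    "Jordan_Normal_Form.Char_Poly"
    "Jordan_Normal_Form.DL_Rank"
begin

unbundle no vec_syntax
no_notation inner (infix "\<bullet>" 70)

text \<open>A linear compartmental model on the vertices \<open>{1..num_comps M}\<close>; an edge
  \<open>i \<rightarrow> j\<close> is the pair \<open>(i, j)\<close>.\<close>

record compartmental_model =
  num_comps :: nat
  edges :: "(nat \<times> nat) set"
  inputs :: "nat set"
  outputs :: "nat set"
  leaks :: "nat set"

definition compartmental_model :: "compartmental_model \<Rightarrow> bool" where
  "compartmental_model M \<longleftrightarrow>
     edges M \<subseteq> {(i, j). i \<in> {1..num_comps M} \<and> j \<in> {1..num_comps M} \<and> i \<noteq> j} \<and>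
     inputs M \<subseteq> {1..num_comps M} \<and>
     outputs M \<subseteq> {1..num_comps M} \<and>
     leaks M \<subseteq> {1..num_comps M}"

text \<open>The index \<open>(j, i)\<close> stands for the parameter \<open>a\<^sub>j\<^sub>i\<close>, which belongs to the edge
  \<open>i \<rightarrow> j\<close> if \<open>j \<noteq> 0\<close> and to the leak in \<open>i\<close> if \<open>j = 0\<close>.\<close>

definition params :: "compartmental_model \<Rightarrow> (nat \<times> nat) set" where
  "params M = {(j, i). (i, j) \<in> edges M} \<union> {(0, i) | i. i \<in> leaks M}"

definition param_space :: "compartmental_model \<Rightarrow> (nat \<times> nat \<Rightarrow> real) set" where
  "param_space M = (\<Pi>\<^sub>E p\<in>params M. UNIV)"

definition compartmental_entry ::
  "compartmental_model \<Rightarrow> (nat \<times> nat \<Rightarrow> real) \<Rightarrow> nat \<Rightarrow> nat \<Rightarrow> real" where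
  "compartmental_entry M a i j =
     (if i \<noteq> j then (if (j, i) \<in> edges M then a (i, j) else 0)
      else - (\<Sum>k | (i, k) \<in> edges M. a (k, i)) - (if i \<in> leaks M then a (0, i) else 0))"

text \<open>Matrices are indexed from 0, vertices from 1.\<close>

definition compartmental_matrix ::
  "compartmental_model \<Rightarrow> (nat \<times> nat \<Rightarrow> real) \<Rightarrow> real mat" where
  "compartmental_matrix M a =
     mat (num_comps M) (num_comps M) (\<lambda>(i, j). compartmental_entry M a (i + 1) (j + 1))"

text \<open>The coefficient map \<open>(c\<^sub>0, \<dots>, c\<^sub>n\<^sub>-\<^sub>1, d\<^sub>0, \<dots>, d\<^sub>n\<^sub>-\<^sub>2)\<close> of a model with
  \<open>inputs M = outputs M = {1}\<close>; it is not the right map for other inputs and outputs.\<close>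

definition num_coeffs :: "compartmental_model \<Rightarrow> nat" where
  "num_coeffs M = 2 * num_comps M - 1"

definition coeff_map :: "compartmental_model \<Rightarrow> (nat \<times> nat \<Rightarrow> real) \<Rightarrow> real vec" where
  "coeff_map M a =
     vec (num_coeffs M) (\<lambda>i.
       if i < num_comps M
       then coeff (char_poly (compartmental_matrix M a)) i
       else coeff (det (mat_delete (char_poly_matrix (compartmental_matrix M a)) 0 0))
              (i - num_comps M))"

definition generically_locally_identifiable :: "compartmental_model \<Rightarrow> bool" where
  "generically_locally_identifiable M \<longleftrightarrow>
     (AE a in PiM (params M) (\<lambda>_. lborel).
        \<exists>U. openin (product_topology (\<lambda>_. euclidean) (params M)) U \<and> a \<in> U \<and>
            inj_on (coeff_map M) U)"

text \<open>The Jacobian matrix of a map with \<open>m\<close> components; the list \<open>ps\<close> gives the order of the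
  parameters, i.e. of the columns.\<close>

definition jacobian ::
  "nat \<Rightarrow> (nat \<times> nat) list \<Rightarrow> ((nat \<times> nat \<Rightarrow> real) \<Rightarrow> real vec) \<Rightarrow>
   (nat \<times> nat \<Rightarrow> real) \<Rightarrow> real mat" where
  "jacobian m ps F a =
     mat m (length ps) (\<lambda>(i, j). deriv (\<lambda>t. F (a(ps ! j := t)) $ i) (a (ps ! j)))"

definition restricted_coeff_map ::
  "compartmental_model \<Rightarrow> nat list \<Rightarrow> (nat \<times> nat \<Rightarrow> real) \<Rightarrow> real vec" where
  "restricted_coeff_map M rs a = vec (length rs) (\<lambda>i. coeff_map M a $ (rs ! i))"

text \<open>Up to sign, \<open>f\<close> is the determinant of the Jacobian matrix of a restricted coefficient map
  (the coefficients are chosen by the list \<open>rs\<close>) that vanishes exactly where the full Jacobian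
  matrix drops rank. The order \<open>ps\<close> of the parameters is arbitrary; it only affects the sign
  \<open>s\<close>, which must not depend on the point \<open>a\<close>. The notion is meant for generically locally
  identifiable models.\<close>

definition singular_locus_equation ::
  "compartmental_model \<Rightarrow> ((nat \<times> nat \<Rightarrow> real) \<Rightarrow> real) \<Rightarrow> bool" where
  "singular_locus_equation M f \<longleftrightarrow>
     (\<exists>rs. distinct rs \<and> set rs \<subseteq> {..<num_coeffs M} \<and> length rs = card (params M) \<and>
       (\<forall>ps. distinct ps \<and> set ps = params M \<longrightarrow>
         (\<forall>a\<in>param_space M.
            det (jacobian (length rs) ps (restricted_coeff_map M rs) a) = 0 \<longleftrightarrow>
            vec_space.rank (num_coeffs M) (jacobian (num_coeffs M) ps (coeff_map M) a)
              < card (params M)) \<and>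
         (\<exists>s\<in>{1, -1}. \<forall>a\<in>param_space M.
            det (jacobian (length rs) ps (restricted_coeff_map M rs) a) = s * f a)))"

definition cycle_model :: "nat \<Rightarrow> compartmental_model" where
  "cycle_model n =
     \<lparr>num_comps = n,
      edges = {(i, i + 1) | i. 1 \<le> i \<and> i < n} \<union> {(n, 1)},
      inputs = {1}, outputs = {1}, leaks = {1}\<rparr>"

lemma compartmental_model_cycle: "n \<ge> 2 \<Longrightarrow> compartmental_model (cycle_model n)"
  by (auto simp: compartmental_model_def cycle_model_def)

lemma card_params_cycle:
  assumes "n \<ge> 2"
  shows "finite (params (cycle_model n))" "card (params (cycle_model n)) = n + 1"
proof -
  have eq: "params (cycle_model n) =
      insert (0, 1) (insert (1, n) ((\<lambda>i. (i + 1, i)) ` {1..<n}))"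
    by (auto simp: params_def cycle_model_def)
  show "finite (params (cycle_model n))"
    unfolding eq by simp
  have "card ((\<lambda>i::nat. (i + 1, i)) ` {1..<n}) = n - 1"
    by (subst card_image) (auto simp: inj_on_def)
  moreover have "(1, n) \<notin> (\<lambda>i::nat. (i + 1, i)) ` {1..<n}"
    and "(0, 1) \<notin> insert (1, n) ((\<lambda>i::nat. (i + 1, i)) ` {1..<n})"
    by auto
  ultimately show "card (params (cycle_model n)) = n + 1"
    unfolding eq using assms by simp
qed

text \<open>The parameter \<open>a\<^sub>i\<^sub>+\<^sub>1\<^sub>,\<^sub>i\<close> of the edge leaving \<open>i\<close>, where
  \<open>a\<^sub>n\<^sub>+\<^sub>1\<^sub>,\<^sub>n\<close> means \<open>a\<^sub>1\<^sub>,\<^sub>n\<close>.\<close>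

definition cycle_param :: "nat \<Rightarrow> (nat \<times> nat \<Rightarrow> real) \<Rightarrow> nat \<Rightarrow> real" where
  "cycle_param n a i = (if i = n then a (1, n) else a (i + 1, i))"

end

theory Submission
  imports Defs
begin

text \<open>
  Let \<open>x\<^sub>i\<close> be the parameter of the edge leaving \<open>i\<close>, let \<open>l\<close> be the leak parameter and
  \<open>D = (\<lambda> + x\<^sub>2) \<cdots> (\<lambda> + x\<^sub>n)\<close>. The minor of \<open>\<lambda>I - A\<close> is \<open>D\<close> and the determinant is
  \<open>(\<lambda> + x\<^sub>1 + l) D - x\<^sub>1 \<cdots> x\<^sub>n\<close>, so \<open>c\<^sub>0 = l d\<^sub>0\<close> and
  \<open>c\<^sub>k = d\<^sub>k\<^sub>-\<^sub>1 + (x\<^sub>1 + l) d\<^sub>k\<close> for \<open>k > 0\<close>, where \<open>d\<^sub>n\<^sub>-\<^sub>1 = 1\<close>. Hence the gradients of all coefficients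
  are combinations of those of \<open>c\<^sub>0, c\<^sub>n\<^sub>-\<^sub>1, d\<^sub>0, \<dots>, d\<^sub>n\<^sub>-\<^sub>2\<close>. The Jacobian matrix of these \<open>n + 1\<close>
  coefficients is block triangular: the parameters \<open>l, x\<^sub>1\<close> contribute \<open>d\<^sub>0 = x\<^sub>2 \<cdots> x\<^sub>n\<close>, and the
  elementary symmetric polynomials \<open>d\<^sub>k\<close> contribute a Vandermonde product.

  Identifiability needs no inverse function theorem: \<open>D\<close> determines \<open>x\<^sub>2, \<dots>, x\<^sub>n\<close> up to order,
  the order is fixed locally if they are distinct, and if they are also nonzero then
  \<open>c\<^sub>0\<close> and \<open>c\<^sub>n\<^sub>-\<^sub>1\<close> give \<open>l\<close> and \<open>x\<^sub>1\<close>.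
\<close>

section \<open>Linear algebra: column rank, the determinants behind the Jacobian and the cycle
  matrix\<close>

text \<open>For distinct columns, a kernel vector is exactly a linear dependence of the set of
  columns. That set forgets repetitions, hence the case split: if two columns agree, fewer than
  \<open>k\<close> distinct ones remain to bound the rank, and the difference of two unit vectors
  lies in the kernel.\<close>

lemma col_rank_less_iff:
  fixes A :: "real mat"
  assumes A: "A \<in> carrier_mat m k"
  shows "vec_space.rank m A < k \<longleftrightarrow> (\<exists>v. v \<in> carrier_vec k \<and> v \<noteq> 0\<^sub>v k \<and> A *\<^sub>v v = 0\<^sub>v m)"
proof -
  interpret vec_space "TYPE(real)" m .
  show ?thesis
  proof (cases "distinct (cols A)")
    case True
    have "rank A < k \<longleftrightarrow> lin_dep (set (cols A))"
      using full_rank_lin_indpt[OF A _ True] lin_indpt_full_rank[OF A True] rank_le_nc[OF A]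
      by (metis less_irrefl order_le_neq_trans)
    also have "\<dots> \<longleftrightarrow> (\<exists>v. v \<in> carrier_vec k \<and> v \<noteq> 0\<^sub>v k \<and> A *\<^sub>v v = 0\<^sub>v m)"
      using lin_depE[OF A _ True] lin_depI[OF A _ _ _ True] by metis
    finally show ?thesis .
  next
    case False
    then obtain i j where ij: "i < k" "j < k" "i \<noteq> j" "col A i = col A j"
      using A by (auto simp: distinct_conv_nth)
    let ?v = "unit_vec k i - unit_vec k j :: real vec"
    have "?v \<noteq> 0\<^sub>v k"
    proof
      assume "?v = 0\<^sub>v k"
      then have "?v $ i = 0" using ij by simp
      then show False using ij by simp
    qed
    moreover have "A *\<^sub>v ?v = 0\<^sub>v m"
    proof -
      have unit: "A *\<^sub>v unit_vec k l = col A l" if "l < k" for l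
        using A that by (intro eq_vecI) auto
      have "A *\<^sub>v ?v = A *\<^sub>v unit_vec k i - A *\<^sub>v unit_vec k j"
        using A by (intro mult_minus_distrib_mat_vec) auto
      also have "\<dots> = col A i - col A j"
        using ij by (simp add: unit)
      finally show ?thesis using ij A by auto
    qed
    moreover have "?v \<in> carrier_vec k" by simp
    moreover have "rank A < k"
    proof -
      obtain S where S: "maximal S (\<lambda>T. T \<subseteq> set (cols A) \<and> lin_indpt T)"
        using maximal_exists[of "(\<lambda>T. T \<subseteq> set (cols A) \<and> lin_indpt T)" "card (set (cols A))" "{}"]
        by (meson List.finite_set card_mono empty_iff empty_subsetI finite_lin_indpt2 rev_finite_subset)
      then have "card S \<le> card (set (cols A))"
        by (simp add: card_mono maximal_def)
      also have "\<dots> < k"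
        using False A card_distinct[of "cols A"] card_length[of "cols A"] by fastforce
      finally show ?thesis
        using rank_card_indpt[OF A S] by simp
    qed
    ultimately show ?thesis by blast
  qed
qed

lemma det_columns_permuted:
  fixes A :: "'a::comm_ring_1 mat"
  assumes "A \<in> carrier_mat n n" "p permutes {0..<n}"
  shows "det (mat n n (\<lambda>(i, j). A $$ (i, p j))) = signof p * det A"
proof -
  have "det (mat n n (\<lambda>(i, j). A $$ (i, p j))) =
      det (mat n n (\<lambda>(i, j). A\<^sup>T $$ (p i, j)))"
    using assms permutes_in_image[OF assms(2)]
    by (subst det_transpose[symmetric, of _ n], simp, intro arg_cong[where f = det] eq_matI) auto
  also have "\<dots> = signof p * det A"
    using assms by (simp add: det_permute_rows det_transpose)
  finally show ?thesis .
qed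

lemma degree_prod_linear:
  "finite I \<Longrightarrow> degree (\<Prod>j\<in>I. [:x j, 1:] :: 'a::idom poly) = card I"
  by (subst degree_prod_sum_eq) auto

lemma monic_prod_linear:
  "finite I \<Longrightarrow> coeff (\<Prod>j\<in>I. [:x j, 1:] :: 'a::idom poly) (card I) = 1"
  using degree_prod_linear[of I x] monic_prod[of I "\<lambda>j. [:x j, 1:]"] by auto

text \<open>Omitting the factor \<open>i\<close> differentiates the product of all
  \<open>[:x j, 1:]\<close> with respect to \<open>x i\<close>, so this is the Jacobian determinant
  of the elementary symmetric polynomials. Induction on \<open>N\<close> splits off the factors that
  involve \<open>x N\<close>.\<close>

lemma det_prod_linear_omit:
  fixes x :: "nat \<Rightarrow> 'a::idom"
  shows "det (mat N N (\<lambda>(k, i). coeff (\<Prod>j\<in>{..<N} - {i}. [:x j, 1:]) k)) =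
    (\<Prod>j<N. \<Prod>i<j. x j - x i)"
proof (induction N)
  case 0
  show ?case by (simp add: det_def)
next
  case (Suc N)
  define M where "M N = mat N N (\<lambda>(k, i). coeff (\<Prod>j\<in>{..<N} - {i}. [:x j, 1:]) k)" for N
  \<comment> \<open>Multiplication by \<open>U\<close> subtracts the last column from the others: this divides out
    \<open>x N - x i\<close> and lowers the degree, so the last row becomes a unit vector.\<close>
  define U where "U = mat (Suc N) (Suc N)
     (\<lambda>(i, j). if i = j then 1 else if i = N then - 1 else 0 :: 'a)"
  define W where "W = mat N N (\<lambda>(i, j). if i = j then x N - x i else 0)"
  define L where "L = mat N 1 (\<lambda>(k, i). coeff (\<Prod>j<N. [:x j, 1:]) k)"
  have M: "M N \<in> carrier_mat N N" for N by (simp add: M_def)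
  have U: "U \<in> carrier_mat (Suc N) (Suc N)" by (simp add: U_def)
  have W: "W \<in> carrier_mat N N" by (simp add: W_def)
  have detU: "det U = 1"
    by (subst det_lower_triangular[of "Suc N"])
      (auto simp: U_def prod_list_diag_prod)
  have detW: "det W = (\<Prod>i<N. x N - x i)"
    by (subst det_lower_triangular[of N])
      (auto simp: W_def prod_list_diag_prod atLeast0LessThan)
  have step: "(\<Prod>j\<in>{..<Suc N} - {i}. [:x j, 1:]) - (\<Prod>j<N. [:x j, 1:]) =
      Polynomial.smult (x N - x i) (\<Prod>j\<in>{..<N} - {i}. [:x j, 1:])" if "i < N" for i
  proof -
    have "(\<Prod>j\<in>{..<Suc N} - {i}. [:x j, 1:]) = [:x N, 1:] * (\<Prod>j\<in>{..<N} - {i}. [:x j, 1:])"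
    proof -
      have "{..<Suc N} - {i} = insert N ({..<N} - {i})" using that by auto
      then show ?thesis by simp
    qed
    moreover have "(\<Prod>j<N. [:x j, 1:]) = [:x i, 1:] * (\<Prod>j\<in>{..<N} - {i}. [:x j, 1:])"
      using that by (subst prod.remove[of _ i]) auto
    ultimately show ?thesis
      by (simp add: smult_diff_left)
  qed
  have deg: "degree (\<Prod>j\<in>{..<N} - {i}. [:x j, 1:]) < N" if "i < N" for i
    using that by (subst degree_prod_linear) auto
  \<comment> \<open>The last column of \<open>M (Suc N)\<close> omits \<open>x N\<close>, so it is a
    monic product of degree \<open>N\<close>: \<open>L\<close> holds its lower coefficients and the
    corner its leading 1.\<close>
  have "M (Suc N) * U = four_block_mat (M N * W) L (0\<^sub>m 1 N) (1\<^sub>m 1)" (is "?A = ?B")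
  proof (rule eq_matI)
    fix k i assume "k < dim_row ?B" "i < dim_col ?B"
    then have ki: "k < Suc N" "i < Suc N" using M[of N] W by auto
    have MU: "(M (Suc N) * U) $$ (k, i) =
        (if i = N then M (Suc N) $$ (k, N) else M (Suc N) $$ (k, i) - M (Suc N) $$ (k, N))"
    proof -
      have "(M (Suc N) * U) $$ (k, i) = (\<Sum>l<Suc N. M (Suc N) $$ (k, l) * U $$ (l, i))"
        using ki M[of "Suc N"] U by (simp add: scalar_prod_def atLeast0LessThan)
      also have "\<dots> = (\<Sum>l<N. if l = i then M (Suc N) $$ (k, l) else 0) +
          M (Suc N) $$ (k, N) * (if i = N then 1 else - 1)"
      proof -
        have "(\<Sum>l<N. M (Suc N) $$ (k, l) * U $$ (l, i)) =
            (\<Sum>l<N. if l = i then M (Suc N) $$ (k, l) else 0)"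
          using ki by (intro sum.cong) (auto simp: U_def)
        then show ?thesis using ki by (simp add: U_def)
      qed
      finally show ?thesis using ki by (auto simp: less_Suc_eq)
    qed
    have MW: "(M N * W) $$ (k, i) = M N $$ (k, i) * (x N - x i)" if "k < N" "i < N"
    proof -
      have "(M N * W) $$ (k, i) = (\<Sum>l<N. M N $$ (k, l) * W $$ (l, i))"
        using that M[of N] W by (simp add: scalar_prod_def atLeast0LessThan)
      also have "\<dots> = (\<Sum>l<N. if l = i then M N $$ (k, l) * (x N - x i) else 0)"
        using that by (intro sum.cong) (auto simp: W_def)
      finally show ?thesis using that by simp
    qed
    have last: "{..<Suc N} - {N} = {..<N}" by auto
    show "?A $$ (k, i) = ?B $$ (k, i)"
    proof (cases "i = N")
      case True
      then have "?A $$ (k, i) = coeff (\<Prod>j<N. [:x j, 1:]) k"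
        unfolding MU using ki by (simp add: M_def last)
      then show ?thesis
        using True ki M[of N] W monic_prod_linear[of "{..<N}" x]
        by (auto simp: L_def less_Suc_eq)
    next
      case False
      then have i: "i < N" using ki by simp
      have "?A $$ (k, i) = coeff (Polynomial.smult (x N - x i) (\<Prod>j\<in>{..<N} - {i}. [:x j, 1:])) k"
        unfolding MU step[OF i, symmetric] using ki i by (simp add: M_def last)
      moreover have "?B $$ (k, i) =
          (if k = N then 0 else M N $$ (k, i) * (x N - x i))"
        using ki i M[of N] W MW by (auto simp: less_Suc_eq simp del: index_mult_mat(1))
      ultimately show ?thesis
        using ki i coeff_eq_0[OF deg[OF i]] by (auto simp: M_def less_Suc_eq)
    qed
  qed (use M[of "Suc N"] M[of N] U W in auto)
  then have "det (M (Suc N) * U) = det (M N * W) * det (1\<^sub>m 1 :: 'a mat)"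
    using det_four_block_mat_lower_left_zero[of "M N * W" N L 1 "0\<^sub>m 1 N" "1\<^sub>m 1"] M[of N] W
    by (simp add: L_def)
  then have "det (M (Suc N)) = det (M N) * (\<Prod>i<N. x N - x i)"
    using detU detW det_mult[OF M U] det_mult[OF M W] by simp
  then show ?case using Suc.IH by (simp add: M_def)
qed

text \<open>Nonzero entries lie only on the diagonal, just below it, and in the corner
  \<open>(0, m)\<close>. Row 0 thus has two terms in its Laplace expansion; the minor at
  \<open>(0, 0)\<close> is lower triangular, and the one at \<open>(0, m)\<close> is upper
  triangular with the subdiagonal of \<open>A\<close> as its diagonal.\<close>

lemma
  fixes A :: "'a::comm_ring_1 mat"
  assumes A: "A \<in> carrier_mat (Suc m) (Suc m)" and m: "m > 0"
    and zero: "\<And>i j. i \<le> m \<Longrightarrow> j \<le> m \<Longrightarrow> i \<noteq> j \<Longrightarrow> i \<noteq> Suc j \<Longrightarrow> (i, j) \<noteq> (0, m) \<Longrightarrow>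
      A $$ (i, j) = 0"
  shows det_cyclic_delete: "det (mat_delete A 0 0) = (\<Prod>i = 1..m. A $$ (i, i))"
    and det_cyclic: "det A = A $$ (0, 0) * (\<Prod>i = 1..m. A $$ (i, i)) +
      (- 1) ^ m * A $$ (0, m) * (\<Prod>i<m. A $$ (Suc i, i))"
proof -
  show 1: "det (mat_delete A 0 0) = (\<Prod>i = 1..m. A $$ (i, i))"
  proof -
    have "det (mat_delete A 0 0) = (\<Prod>i<m. A $$ (Suc i, Suc i))"
      using A zero by (subst det_lower_triangular[of m])
        (auto simp: mat_delete_def prod_list_diag_prod atLeast0LessThan)
    then show ?thesis
      by (simp add: prod.atLeast1_atMost_eq)
  qed
  have 2: "det (mat_delete A 0 m) = (\<Prod>i<m. A $$ (Suc i, i))"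
    using A zero by (subst det_upper_triangular[of _ m])
      (auto simp: mat_delete_def prod_list_diag_prod atLeast0LessThan)
  have "det A = (\<Sum>j<Suc m. A $$ (0, j) * cofactor A 0 j)"
    by (rule laplace_expansion_row[OF A]) simp
  also have "\<dots> = (\<Sum>j\<in>{0, m}. A $$ (0, j) * cofactor A 0 j)"
    using zero by (intro sum.mono_neutral_right) auto
  finally show "det A = A $$ (0, 0) * (\<Prod>i = 1..m. A $$ (i, i)) +
      (- 1) ^ m * A $$ (0, m) * (\<Prod>i<m. A $$ (Suc i, i))"
    using m 1 2 by (simp add: cofactor_def algebra_simps)
qed

section \<open>Null sets in the parameter space\<close>

text \<open>Tonelli, with the coordinate \<open>p\<close> integrated first. It reduces genericity in
  many parameters to avoiding a null set of values of a single one.\<close>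

lemma AE_PiM_lborel_fun_upd:
  fixes P :: "('i \<Rightarrow> real) \<Rightarrow> bool"
  assumes "finite I" "p \<in> I"
    and meas: "{a \<in> space (PiM I (\<lambda>_. lborel)). P a} \<in> sets (PiM I (\<lambda>_. lborel))"
    and null: "\<And>a. AE t in lborel. P (a(p := t))"
  shows "AE a in PiM I (\<lambda>_. lborel). P a"
proof -
  interpret product_sigma_finite "\<lambda>_::'i. lborel :: real measure"
    by standard
  let ?M = "PiM I (\<lambda>_. lborel :: real measure)"
  let ?N = "{a \<in> space ?M. \<not> P a}"
  define J where "J = I - {p}"
  have J: "finite J" "p \<notin> J" "insert p J = I"
    using assms by (auto simp: J_def)
  have N: "?N \<in> sets ?M"
    using sets.sets_Collect_neg[OF meas] .
  have "emeasure ?M ?N = (\<integral>\<^sup>+ a. indicator ?N a \<partial>?M)"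
    using N by simp
  also have "\<dots> = (\<integral>\<^sup>+ b. (\<integral>\<^sup>+ t. indicator ?N (b(p := t)) \<partial>lborel) \<partial>PiM J (\<lambda>_. lborel))"
    using product_nn_integral_insert[OF J(1,2), of "indicator ?N"] N J(3) by simp
  also have "\<dots> = (\<integral>\<^sup>+ b. 0 \<partial>PiM J (\<lambda>_. lborel :: real measure))"
  proof (rule nn_integral_cong)
    fix b
    have "AE t in lborel. indicator ?N (b(p := t)) = (0::ennreal)"
      using null[of b] by eventually_elim auto
    then show "(\<integral>\<^sup>+ t. indicator ?N (b(p := t)) \<partial>lborel) = 0"
      by (subst nn_integral_cong_AE[of _ "\<lambda>_. 0"]) auto
  qed
  finally show ?thesis
    using N by (intro AE_I[of _ _ ?N]) auto
qed

section \<open>Characteristic polynomial and coefficients of the cycle model\<close>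

text \<open>The index behind the value \<open>cycle_param n a i\<close>; updates
  \<open>a(p := t)\<close> and the columns of the Jacobian need the index itself.\<close>

definition cycle_index :: "nat \<Rightarrow> nat \<Rightarrow> nat \<times> nat" where
  "cycle_index n i = (if i = n then (1, n) else (i + 1, i))"

lemma cycle_param_eq: "cycle_param n a i = a (cycle_index n i)"
  by (simp add: cycle_param_def cycle_index_def)

lemma cycle_index_inject [simp]: "cycle_index n i = cycle_index n j \<longleftrightarrow> i = j"
  by (auto simp: cycle_index_def)

lemma cycle_index_not_leak [simp]: "cycle_index n i \<noteq> (0, j)" "(0, j) \<noteq> cycle_index n i"
  by (auto simp: cycle_index_def)

lemma params_cycle:
  assumes "n \<ge> 1"
  shows "params (cycle_model n) = insert (0, 1) (cycle_index n ` {1..n})"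
proof -
  have "{1..n} = insert n {1..<n}" using assms by auto
  moreover have "cycle_index n ` {1..<n} = (\<lambda>i. (i + 1, i)) ` {1..<n}"
    by (auto simp: cycle_index_def)
  ultimately show ?thesis
    by (auto simp: params_def cycle_model_def cycle_index_def)
qed

text \<open>The polynomial \<open>D\<close> of the outline. Its coefficients below degree
  \<open>n - 1\<close> are the \<open>d\<close> coefficients.\<close>

definition leaving_poly :: "nat \<Rightarrow> (nat \<times> nat \<Rightarrow> real) \<Rightarrow> real poly" where
  "leaving_poly n a = (\<Prod>i = 2..n. [:cycle_param n a i, 1:])"

lemma char_poly_matrix_cycle_entry:
  assumes "n \<ge> 3" "i < n" "j < n"
  shows "char_poly_matrix (compartmental_matrix (cycle_model n) a) $$ (i, j) =
    (if i = j then [:cycle_param n a (i + 1) + (if i = 0 then a (0, 1) else 0), 1:]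
     else if i = Suc j \<or> (i, j) = (0, n - 1) then [:- cycle_param n a (j + 1):] else 0)"
proof -
  \<comment> \<open>Each compartment has one outgoing edge, so the diagonal sum has one
    term.\<close>
  have out: "{k. (Suc i, k) \<in> edges (cycle_model n)} = {if Suc i = n then 1 else Suc (Suc i)}"
    using assms by (auto simp: cycle_model_def)
  have "edges (cycle_model n) = {(i, i + 1) | i. 1 \<le> i \<and> i < n} \<union> {(n, 1)}"
    "leaks (cycle_model n) = {1}" "num_comps (cycle_model n) = n"
    by (simp_all add: cycle_model_def)
  with assms show ?thesis
    unfolding char_poly_matrix_def compartmental_matrix_def
    by (auto simp: compartmental_entry_def out cycle_param_def)
qed

lemma
  assumes n: "n \<ge> 3"
  shows det_delete_cycle: "det (mat_delete (char_poly_matrix (compartmental_matrix (cycle_model n) a)) 0 0) =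
      leaving_poly n a"
    and char_poly_cycle: "char_poly (compartmental_matrix (cycle_model n) a) =
      [:cycle_param n a 1 + a (0, 1), 1:] * leaving_poly n a - [:\<Prod>i = 1..n. cycle_param n a i:]"
proof -
  obtain m where m: "n = Suc m" "m \<ge> 2" using n by (cases n) auto
  let ?A = "char_poly_matrix (compartmental_matrix (cycle_model n) a)"
  have A: "?A \<in> carrier_mat (Suc m) (Suc m)"
    unfolding m(1)[symmetric]
    by (intro char_poly_matrix_closed) (simp add: compartmental_matrix_def cycle_model_def)
  note entry = char_poly_matrix_cycle_entry[OF n] char_poly_matrix_cycle_entry[OF n, unfolded m(1)]
  have zero: "?A $$ (i, j) = 0"
    if "i \<le> m" "j \<le> m" "i \<noteq> j" "i \<noteq> Suc j" "(i, j) \<noteq> (0, m)" for i j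
    using that m by (subst entry) auto
  have D: "(\<Prod>i = 1..m. ?A $$ (i, i)) = leaving_poly n a"
  proof -
    have "(\<Prod>i = 1..m. ?A $$ (i, i)) = (\<Prod>i = 1..m. [:cycle_param n a (Suc i), 1:])"
      using m by (intro prod.cong) (auto simp: entry)
    also have "\<dots> = leaving_poly n a"
      unfolding leaving_poly_def m(1)
      by (subst prod.shift_bounds_cl_Suc_ivl[symmetric]) (simp add: numeral_2_eq_2)
    finally show ?thesis .
  qed
  show "det (mat_delete ?A 0 0) = leaving_poly n a"
    using det_cyclic_delete[OF A _ zero] m D by simp
  have const: "(\<Prod>i\<in>I. [:f i:]) = [:\<Prod>i\<in>I. f i:]" for f :: "nat \<Rightarrow> real" and I
    by (induction I rule: infinite_finite_induct) (auto simp: one_pCons)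
  \<comment> \<open>The cofactor sign \<open>(- 1) ^ m\<close> cancels against the signs of the
    \<open>m\<close> subdiagonal entries; the remaining minus comes from the corner entry.\<close>
  have "(- 1) ^ m * ?A $$ (0, m) * (\<Prod>i<m. ?A $$ (Suc i, i)) =
      - [:\<Prod>i = 1..n. cycle_param n a i:]"
  proof -
    have "(\<Prod>i<m. ?A $$ (Suc i, i)) = (\<Prod>i<m. [:- cycle_param n a (Suc i):])"
      using m by (intro prod.cong) (auto simp: entry)
    also have "\<dots> = [:(- 1) ^ m * (\<Prod>i<m. cycle_param n a (Suc i)):]"
      by (simp add: const prod_uminus)
    also have "(\<Prod>i<m. cycle_param n a (Suc i)) = (\<Prod>i = 1..m. cycle_param n a i)"
      by (simp add: prod.atLeast1_atMost_eq)
    finally have "(\<Prod>i<m. ?A $$ (Suc i, i)) = [:(- 1) ^ m * (\<Prod>i = 1..m. cycle_param n a i):]" .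
    moreover have "?A $$ (0, m) = [:- cycle_param n a n:]"
      using m by (simp add: entry)
    moreover have "(- 1 :: real poly) ^ m = [:(- 1) ^ m:]"
      by (induction m) (auto simp: one_pCons)
    ultimately show ?thesis
      using m by (simp add: mult_ac power_mult_distrib[symmetric] flip: power_add mult_2)
  qed
  moreover have "?A $$ (0, 0) = [:cycle_param n a 1 + a (0, 1), 1:]"
    using n by (simp add: entry)
  ultimately show "char_poly (compartmental_matrix (cycle_model n) a) =
      [:cycle_param n a 1 + a (0, 1), 1:] * leaving_poly n a - [:\<Prod>i = 1..n. cycle_param n a i:]"
    using det_cyclic[OF A _ zero] m D by (simp add: char_poly_def)
qed

text \<open>Compare coefficients in \<open>char_poly_cycle\<close>. The subtracted constant is the
  first edge parameter times \<open>d_0\<close>, which cancels against part of the constant term and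
  leaves only the leak times \<open>d_0\<close>.\<close>

lemma coeff_map_cycle:
  assumes n: "n \<ge> 3" and k: "k < 2 * n - 1"
  shows "coeff_map (cycle_model n) a $ k =
    (if k = 0 then a (0, 1) * coeff (leaving_poly n a) 0
     else if k < n then coeff (leaving_poly n a) (k - 1) +
       (cycle_param n a 1 + a (0, 1)) * coeff (leaving_poly n a) k
     else coeff (leaving_poly n a) (k - n))"
proof -
  have 0: "coeff (leaving_poly n a) 0 = (\<Prod>i = 2..n. cycle_param n a i)"
    by (simp add: leaving_poly_def poly_prod flip: poly_0_coeff_0)
  have 1: "(\<Prod>i = 1..n. cycle_param n a i) = cycle_param n a 1 * (\<Prod>i = 2..n. cycle_param n a i)"
    using n by (subst prod.atLeast_Suc_atMost) (auto simp: numeral_2_eq_2)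
  have "num_comps (cycle_model n) = n" by (simp add: cycle_model_def)
  then show ?thesis
    using n k
    by (auto simp: coeff_map_def num_coeffs_def det_delete_cycle char_poly_cycle 0 1[simplified]
        coeff_pCons algebra_simps split: nat.splits)
qed

section \<open>Partial derivatives of the coefficients\<close>

lemma leaving_poly_upd:
  assumes "i \<in> {2..n}"
  shows "leaving_poly n (a(cycle_index n i := t)) =
    [:t, 1:] * (\<Prod>j\<in>{2..n} - {i}. [:cycle_param n a j, 1:])"
  unfolding leaving_poly_def using assms
  by (subst prod.remove[of _ i]) (auto simp: cycle_param_eq intro!: prod.cong)

lemma leaving_poly_upd_other:
  assumes "p \<notin> cycle_index n ` {2..n}"
  shows "leaving_poly n (a(p := t)) = leaving_poly n a"
  unfolding leaving_poly_def using assms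
  by (intro prod.cong) (auto simp: cycle_param_eq)

text \<open>The partial derivative of \<open>leaving_poly\<close> in the direction \<open>p\<close>.
  Filtering the factors by their index avoids choosing an \<open>i\<close> with
  \<open>p = cycle_index n i\<close>.\<close>

definition leaving_poly_deriv :: "nat \<Rightarrow> (nat \<times> nat \<Rightarrow> real) \<Rightarrow> nat \<times> nat \<Rightarrow> real poly" where
  "leaving_poly_deriv n a p =
     (if p \<in> cycle_index n ` {2..n}
      then \<Prod>j\<in>{j \<in> {2..n}. cycle_index n j \<noteq> p}. [:cycle_param n a j, 1:] else 0)"

lemma leaving_poly_deriv_index:
  "i \<in> {2..n} \<Longrightarrow> leaving_poly_deriv n a (cycle_index n i) =
     (\<Prod>j\<in>{2..n} - {i}. [:cycle_param n a j, 1:])"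
  by (auto simp: leaving_poly_deriv_def intro!: prod.cong)

text \<open>Each parameter occurs in at most one linear factor, so every coefficient is affine in
  \<open>t\<close>, with slope given by the product of the other factors.\<close>

lemma has_field_derivative_coeff_leaving_poly:
  "((\<lambda>t. coeff (leaving_poly n (a(p := t))) k) has_field_derivative
     coeff (leaving_poly_deriv n a p) k) (at t)"
proof (cases "p \<in> cycle_index n ` {2..n}")
  case True
  then obtain i where i: "i \<in> {2..n}" "p = cycle_index n i" by auto
  let ?Q = "\<Prod>j\<in>{2..n} - {i}. [:cycle_param n a j, 1:]"
  have "coeff (leaving_poly n (a(p := t))) k = t * coeff ?Q k + coeff (pCons 0 ?Q) k" for t
    unfolding i leaving_poly_upd[OF i(1)] by simp
  moreover have "((\<lambda>t. t * coeff ?Q k + coeff (pCons 0 ?Q) k) has_field_derivative coeff ?Q k) (at t)"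
    by (auto intro!: derivative_eq_intros)
  ultimately show ?thesis
    using i by (simp add: leaving_poly_deriv_index)
next
  case False
  then show ?thesis
    by (simp add: leaving_poly_upd_other leaving_poly_deriv_def)
qed

text \<open>This is the convention \<open>d_(n-1) = 1\<close>, which lets \<open>c_(n-1)\<close>
  share the formula of the other \<open>c_k\<close>.\<close>

lemma coeff_leaving_poly_top:
  assumes "n \<ge> 3"
  shows "coeff (leaving_poly n a) (n - 1) = 1" "coeff (leaving_poly_deriv n a p) (n - 1) = 0"
proof -
  show "coeff (leaving_poly n a) (n - 1) = 1"
    using monic_prod_linear[of "{2..n}" "cycle_param n a"] by (simp add: leaving_poly_def)
  have "degree (leaving_poly_deriv n a p) < n - 1"
  proof (cases "p \<in> cycle_index n ` {2..n}")
    case True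
    then obtain i where i: "i \<in> {2..n}" "p = cycle_index n i" by auto
    then show ?thesis
      unfolding i leaving_poly_deriv_index[OF i(1)]
      using assms by (subst degree_prod_linear) auto
  qed (use assms in \<open>simp add: leaving_poly_deriv_def\<close>)
  then show "coeff (leaving_poly_deriv n a p) (n - 1) = 0"
    by (rule coeff_eq_0)
qed

text \<open>The formulas of \<open>coeff_map_cycle\<close> differentiated by the product rule; the
  \<open>of_bool\<close> factors are the derivatives of the leak and of the sum of the leak and the
  first edge parameter.\<close>

definition coeff_partial :: "nat \<Rightarrow> (nat \<times> nat \<Rightarrow> real) \<Rightarrow> nat \<Rightarrow> nat \<times> nat \<Rightarrow> real" where
  "coeff_partial n a k p =
    (if k = 0 then of_bool (p = (0, 1)) * coeff (leaving_poly n a) 0 +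
       a (0, 1) * coeff (leaving_poly_deriv n a p) 0
     else if k < n then coeff (leaving_poly_deriv n a p) (k - 1) +
       of_bool (p = cycle_index n 1 \<or> p = (0, 1)) * coeff (leaving_poly n a) k +
       (cycle_param n a 1 + a (0, 1)) * coeff (leaving_poly_deriv n a p) k
     else coeff (leaving_poly_deriv n a p) (k - n))"

lemma deriv_coeff_map_cycle:
  assumes n: "n \<ge> 3" and k: "k < 2 * n - 1"
  shows "deriv (\<lambda>t. coeff_map (cycle_model n) (a(p := t)) $ k) (a p) = coeff_partial n a k p"
proof (rule DERIV_imp_deriv)
  note D = has_field_derivative_coeff_leaving_poly
  have leak: "((\<lambda>t. (a(p := t)) (0, 1)) has_field_derivative of_bool (p = (0, 1))) (at (a p))"
    by (cases "p = (0, 1)") auto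
  have first: "((\<lambda>t. cycle_param n (a(p := t)) 1) has_field_derivative
      of_bool (p = cycle_index n 1)) (at (a p))"
    by (cases "p = cycle_index n 1") (auto simp: cycle_param_eq)
  show "((\<lambda>t. coeff_map (cycle_model n) (a(p := t)) $ k) has_field_derivative
      coeff_partial n a k p) (at (a p))"
  proof -
    consider "k = 0" | "0 < k" "k < n" | "n \<le> k" by linarith
    then show ?thesis
    proof cases
      case 1
      show ?thesis
        unfolding coeff_map_cycle[OF n k] coeff_partial_def
        using DERIV_mult[OF leak D[of n a p 0]] 1 by (simp add: ac_simps)
    next
      case 2
      have "of_bool (p = cycle_index n 1 \<or> p = (0, 1)) =
          (of_bool (p = cycle_index n 1) + of_bool (p = (0, 1)) :: real)"
        by auto
      then show ?thesis
        unfolding coeff_map_cycle[OF n k] coeff_partial_def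
        using DERIV_add[OF D[of n a p "k - 1"] DERIV_mult[OF DERIV_add[OF first leak] D[of n a p k]]] 2
        by (simp add: ac_simps)
    next
      case 3
      then show ?thesis
        unfolding coeff_map_cycle[OF n k] coeff_partial_def
        using D[of n a p "k - n"] n by simp
    qed
  qed
qed

lemma num_coeffs_cycle: "num_coeffs (cycle_model n) = 2 * n - 1"
  by (simp add: num_coeffs_def cycle_model_def)

lemma jacobian_coeff_map_cycle:
  assumes "n \<ge> 3"
  shows "jacobian (2 * n - 1) ps (coeff_map (cycle_model n)) a =
    mat (2 * n - 1) (length ps) (\<lambda>(k, j). coeff_partial n a k (ps ! j))"
  using assms
  by (intro eq_matI) (simp_all add: jacobian_def deriv_coeff_map_cycle)

section \<open>The restricted coefficient map and the rank of the full Jacobian\<close>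

text \<open>The positions of \<open>c_0\<close>, \<open>c_(n-1)\<close>, \<open>d_0\<close>, ...,
  \<open>d_(n-2)\<close>.\<close>

definition chosen_coeffs :: "nat \<Rightarrow> nat list" where
  "chosen_coeffs n = 0 # [n - 1..<2 * n - 1]"

lemma jacobian_restricted_cycle:
  assumes "n \<ge> 3"
  shows "jacobian (length (chosen_coeffs n)) ps (restricted_coeff_map (cycle_model n) (chosen_coeffs n)) a =
    mat (n + 1) (length ps) (\<lambda>(k, j). coeff_partial n a (chosen_coeffs n ! k) (ps ! j))"
proof -
  have len: "length (chosen_coeffs n) = n + 1"
    using assms by (simp add: chosen_coeffs_def)
  have "chosen_coeffs n ! k < 2 * n - 1" if "k < n + 1" for k
    using assms that by (auto simp: chosen_coeffs_def nth_Cons split: nat.splits)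
  then show ?thesis
    using assms
    by (intro eq_matI) (simp_all add: jacobian_def restricted_coeff_map_def len deriv_coeff_map_cycle)
qed

text \<open>The omitted rows, those of \<open>c_k\<close> with \<open>0 < k < n - 1\<close>, are
  combinations of the chosen ones at each point. Phrased with kernel vectors, this needs no explicit
  combination.\<close>

lemma coeff_partial_kernel:
  fixes v :: "nat \<Rightarrow> real"
  assumes n: "n \<ge> 3"
    and chosen: "\<And>k. k \<in> set (chosen_coeffs n) \<Longrightarrow> (\<Sum>j<m. coeff_partial n a k (ps j) * v j) = 0"
    and k: "k < 2 * n - 1"
  shows "(\<Sum>j<m. coeff_partial n a k (ps j) * v j) = 0"
proof -
  \<comment> \<open>\<open>dD k\<close> is the derivative of \<open>d_k\<close> along
    \<open>v\<close>, and \<open>w\<close> that of the sum of the leak and the first edge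
    parameter.\<close>
  define dD where "dD k = (\<Sum>j<m. coeff (leaving_poly_deriv n a (ps j)) k * v j)" for k
  define w where "w = (\<Sum>j<m. of_bool (ps j = cycle_index n 1 \<or> ps j = (0, 1)) * v j)"
  have set: "set (chosen_coeffs n) = insert 0 {n - 1..<2 * n - 1}"
    by (simp add: chosen_coeffs_def)
  have mid: "(\<Sum>j<m. coeff_partial n a k (ps j) * v j) =
      dD (k - 1) + coeff (leaving_poly n a) k * w + (cycle_param n a 1 + a (0, 1)) * dD k"
    if "0 < k" "k < n" for k
    using that unfolding dD_def w_def coeff_partial_def sum_distrib_left sum.distrib[symmetric]
    by (intro sum.cong) (simp_all add: algebra_simps)
  have low: "dD k = 0" if "k < n" for k
  proof (cases "k = n - 1")
    case True
    then show ?thesis using coeff_leaving_poly_top(2)[OF n] by (simp add: dD_def)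
  next
    case False
    with that have "k + n \<in> set (chosen_coeffs n)" by (auto simp: set)
    from chosen[OF this] show ?thesis
      using n by (simp add: dD_def coeff_partial_def)
  qed
  \<comment> \<open>In the row of \<open>c_(n-1)\<close> the factor of \<open>w\<close> is the
    leading coefficient 1, and both \<open>dD\<close> terms vanish.\<close>
  have "w = 0"
    using mid[of "n - 1"] chosen[of "n - 1"] low[of "n - 1"] low[of "n - 1 - 1"]
      coeff_leaving_poly_top(1)[OF n, of a] n
    by (simp add: set)
  show ?thesis
  proof (cases "k \<in> set (chosen_coeffs n)")
    case False
    then have "0 < k" "k < n" using k by (auto simp: set)
    then show ?thesis
      using mid[of k] low[of k] low[of "k - 1"] \<open>w = 0\<close> by simp
  qed (rule chosen)
qed

text \<open>Both sides assert a nonzero kernel vector, and the two matrices have the same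
  kernel.\<close>

lemma cycle_rank_iff:
  assumes n: "n \<ge> 3" and len: "length ps = n + 1"
  shows "det (jacobian (length (chosen_coeffs n)) ps
        (restricted_coeff_map (cycle_model n) (chosen_coeffs n)) a) = 0 \<longleftrightarrow>
    vec_space.rank (num_coeffs (cycle_model n))
      (jacobian (num_coeffs (cycle_model n)) ps (coeff_map (cycle_model n)) a) < n + 1"
proof -
  let ?R = "mat (n + 1) (n + 1) (\<lambda>(k, j). coeff_partial n a (chosen_coeffs n ! k) (ps ! j))"
  let ?J = "mat (2 * n - 1) (n + 1) (\<lambda>(k, j). coeff_partial n a k (ps ! j))"
  have lenrs: "length (chosen_coeffs n) = n + 1"
    using n by (simp add: chosen_coeffs_def)
  have bound: "k < 2 * n - 1" if "k \<in> set (chosen_coeffs n)" for k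
    using that n by (auto simp: chosen_coeffs_def)
  have mult: "(mat r (n + 1) (\<lambda>(k, j). f k j) *\<^sub>v v = 0\<^sub>v r) \<longleftrightarrow>
      (\<forall>k<r. (\<Sum>j<n + 1. f k j * v $ j) = 0)"
    if "v \<in> carrier_vec (n + 1)" for r v and f :: "nat \<Rightarrow> nat \<Rightarrow> real"
    using that by (auto simp: vec_eq_iff scalar_prod_def atLeast0LessThan)
  have "?R *\<^sub>v v = 0\<^sub>v (n + 1) \<longleftrightarrow> ?J *\<^sub>v v = 0\<^sub>v (2 * n - 1)" if v: "v \<in> carrier_vec (n + 1)" for v
  proof -
    have "?R *\<^sub>v v = 0\<^sub>v (n + 1) \<longleftrightarrow>
        (\<forall>k\<in>set (chosen_coeffs n). (\<Sum>j<n + 1. coeff_partial n a k (ps ! j) * v $ j) = 0)"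
      unfolding mult[OF v] by (simp only: all_set_conv_all_nth lenrs)
    also have "\<dots> \<longleftrightarrow> (\<forall>k<2 * n - 1. (\<Sum>j<n + 1. coeff_partial n a k (ps ! j) * v $ j) = 0)"
      using coeff_partial_kernel[OF n, where m = "n + 1" and a = a and ps = "\<lambda>j. ps ! j" and v = "\<lambda>j. v $ j"] bound by blast
    also have "\<dots> \<longleftrightarrow> ?J *\<^sub>v v = 0\<^sub>v (2 * n - 1)"
      unfolding mult[OF v] by simp
    finally show ?thesis .
  qed
  then have "(\<exists>v. v \<in> carrier_vec (n + 1) \<and> v \<noteq> 0\<^sub>v (n + 1) \<and> ?R *\<^sub>v v = 0\<^sub>v (n + 1)) \<longleftrightarrow>
      (\<exists>v. v \<in> carrier_vec (n + 1) \<and> v \<noteq> 0\<^sub>v (n + 1) \<and> ?J *\<^sub>v v = 0\<^sub>v (2 * n - 1))"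
    by (intro arg_cong[where f = Ex] ext conj_cong refl)
  then show ?thesis
    unfolding jacobian_coeff_map_cycle[OF n] jacobian_restricted_cycle[OF n] len num_coeffs_cycle
      col_rank_less_iff[OF mat_carrier] det_0_iff_vec_prod_zero_field[OF mat_carrier] .
qed

section \<open>Generic local identifiability\<close>

lemma nhds_separating:
  fixes x :: "'i \<Rightarrow> real"
  assumes "finite I" "inj_on x I"
  obtains V where "\<And>i. i \<in> I \<Longrightarrow> open (V i) \<and> x i \<in> V i"
    "\<And>i j. i \<in> I \<Longrightarrow> j \<in> I \<Longrightarrow> i \<noteq> j \<Longrightarrow> V i \<inter> V j = {}"
proof
  \<comment> \<open>Voronoi cells: the points strictly closer to \<open>x i\<close> than to any
    other \<open>x j\<close>.\<close>
  define V where "V i = (\<Inter>j\<in>I - {i}. {t. \<bar>t - x i\<bar> < \<bar>t - x j\<bar>})" for i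
  fix i assume i: "i \<in> I"
  have "open {t. \<bar>t - x i\<bar> < \<bar>t - x j\<bar>}" for j
    by (intro open_Collect_less continuous_intros)
  then show "open (V i) \<and> x i \<in> V i"
    using assms i by (auto simp: V_def inj_on_def intro!: open_INT)
  fix j assume "j \<in> I" "i \<noteq> j"
  have False if "t \<in> V i" "t \<in> V j" for t
  proof -
    have "\<bar>t - x i\<bar> < \<bar>t - x j\<bar>" "\<bar>t - x j\<bar> < \<bar>t - x i\<bar>"
      using that i \<open>j \<in> I\<close> \<open>i \<noteq> j\<close> by (auto simp: V_def)
    then show False by simp
  qed
  then show "V i \<inter> V j = {}" by blast
qed

text \<open>The \<open>d\<close> entries together with monicity and the degree determine
  \<open>D\<close>; then \<open>c_0\<close> and \<open>c_(n-1)\<close> give the other two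
  equations.\<close>

lemma coeff_map_cycle_eqD:
  assumes n: "n \<ge> 3" and eq: "coeff_map (cycle_model n) a = coeff_map (cycle_model n) b"
  shows "leaving_poly n a = leaving_poly n b"
    and "a (0, 1) * (\<Prod>i = 2..n. cycle_param n a i) = b (0, 1) * (\<Prod>i = 2..n. cycle_param n b i)"
    and "cycle_param n a 1 + a (0, 1) = cycle_param n b 1 + b (0, 1)"
proof -
  note c = coeff_map_cycle[OF n]
  have eqk: "coeff_map (cycle_model n) a $ k = coeff_map (cycle_model n) b $ k" for k
    using eq by simp
  show D: "leaving_poly n a = leaving_poly n b"
  proof (rule poly_eqI)
    fix k
    have deg: "degree (leaving_poly n a) = n - 1" for a
      unfolding leaving_poly_def using degree_prod_linear[of "{2..n}"] by simp
    consider "k < n - 1" | "k = n - 1" | "k > n - 1" by linarith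
    then show "coeff (leaving_poly n a) k = coeff (leaving_poly n b) k"
    proof cases
      case 1
      then show ?thesis using eqk[of "k + n"] n by (simp add: c)
    next
      case 2
      then show ?thesis using coeff_leaving_poly_top[OF n] by simp
    next
      case 3
      then show ?thesis using deg by (simp add: coeff_eq_0)
    qed
  qed
  have 0: "coeff (leaving_poly n a) 0 = (\<Prod>i = 2..n. cycle_param n a i)" for a
    by (simp add: leaving_poly_def poly_prod flip: poly_0_coeff_0)
  show "a (0, 1) * (\<Prod>i = 2..n. cycle_param n a i) = b (0, 1) * (\<Prod>i = 2..n. cycle_param n b i)"
    using eqk[of 0] n unfolding 0[symmetric] by (simp add: c)
  show "cycle_param n a 1 + a (0, 1) = cycle_param n b 1 + b (0, 1)"
    using eqk[of "n - 1"] n D coeff_leaving_poly_top(1)[OF n] by (simp add: c)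
qed

lemma cycle_locally_injective:
  assumes n: "n \<ge> 3" and a: "a \<in> param_space (cycle_model n)"
    and inj: "inj_on (cycle_param n a) {2..n}"
    and nz: "\<And>i. i \<in> {2..n} \<Longrightarrow> cycle_param n a i \<noteq> 0"
  shows "\<exists>U. openin (product_topology (\<lambda>_. euclidean) (params (cycle_model n))) U \<and> a \<in> U \<and>
    inj_on (coeff_map (cycle_model n)) U"
proof -
  let ?P = "params (cycle_model n)"
  have P: "?P = insert (0, 1) (cycle_index n ` {1..n})"
    using n by (simp add: params_cycle)
  obtain V where V: "\<And>i. i \<in> {2..n} \<Longrightarrow> open (V i) \<and> cycle_param n a i \<in> V i"
    and disj: "\<And>i j. i \<in> {2..n} \<Longrightarrow> j \<in> {2..n} \<Longrightarrow> i \<noteq> j \<Longrightarrow> V i \<inter> V j = {}"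
    using nhds_separating[OF _ inj] by blast
  \<comment> \<open>\<open>U\<close> is a box, unrestricted in the leak and the first edge
    parameter. Excluding 0 on the other sides lets \<open>c_0\<close> determine the leak everywhere
    in \<open>U\<close>.\<close>
  define S where "S p = {t. \<forall>i\<in>{2..n}. p = cycle_index n i \<longrightarrow> t \<in> V i - {0}}" for p
  define U where "U = PiE ?P S"
  have S_index: "S (cycle_index n i) = V i - {0}" if "i \<in> {2..n}" for i
    using that by (auto simp: S_def)
  have S_other: "S p = UNIV" if "p \<notin> cycle_index n ` {2..n}" for p
    using that by (auto simp: S_def)
  have "open (S p)" for p
    using V by (cases "p \<in> cycle_index n ` {2..n}") (auto simp: S_index S_other intro!: open_Diff)
  then have "openin (product_topology (\<lambda>_. euclidean) ?P) U"
    unfolding U_def using card_params_cycle(1)[of n] n by (subst openin_PiE) auto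
  moreover have "a \<in> U"
    unfolding U_def PiE_iff
  proof (intro conjI ballI)
    fix p assume "p \<in> ?P"
    show "a p \<in> S p"
      using V nz by (cases "p \<in> cycle_index n ` {2..n}") (auto simp: S_index S_other cycle_param_eq)
  qed (use a in \<open>simp add: param_space_def PiE_iff\<close>)
  moreover have "inj_on (coeff_map (cycle_model n)) U"
  proof (rule inj_onI)
    fix b c assume b: "b \<in> U" and c: "c \<in> U"
      and eq: "coeff_map (cycle_model n) b = coeff_map (cycle_model n) c"
    note eqs = coeff_map_cycle_eqD[OF n eq]
    have mem: "cycle_param n b i \<in> V i - {0}" "cycle_param n c i \<in> V i - {0}" if "i \<in> {2..n}" for i
      using b c that S_index[OF that] P
      by (auto simp: U_def cycle_param_eq PiE_iff)
    \<comment> \<open>Equal polynomials have equal roots, so the parameter of \<open>b\<close> at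
      \<open>i\<close> is one of \<open>c\<close> at some \<open>j\<close>; disjointness of the
      cells forces \<open>i = j\<close>.\<close>
    have same: "cycle_param n b i = cycle_param n c i" if i: "i \<in> {2..n}" for i
    proof -
      have "poly (leaving_poly n b) (- cycle_param n b i) = 0"
        unfolding leaving_poly_def poly_prod using i
        by (intro prod_zero) auto
      then have "poly (leaving_poly n c) (- cycle_param n b i) = 0"
        unfolding eqs(1) .
      then obtain j where j: "j \<in> {2..n}" "cycle_param n b i = cycle_param n c j"
        by (auto simp: leaving_poly_def poly_prod)
      then have "i = j"
        using disj[OF i j(1)] mem[OF i] mem[OF j(1)] by auto
      then show ?thesis using j by simp
    qed
    have "(\<Prod>i = 2..n. cycle_param n c i) = (\<Prod>i = 2..n. cycle_param n b i)"
      using same by (intro prod.cong) auto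
    moreover have "(\<Prod>i = 2..n. cycle_param n b i) \<noteq> 0"
      using mem by auto
    ultimately have leak: "b (0, 1) = c (0, 1)"
      using eqs(2) by simp
    then have first: "cycle_param n b 1 = cycle_param n c 1"
      using eqs(3) by simp
    show "b = c"
    proof (rule PiE_ext[of b ?P S])
      fix p assume "p \<in> ?P"
      then consider "p = (0, 1)" | "p = cycle_index n 1" | i where "i \<in> {2..n}" "p = cycle_index n i"
        unfolding P by (force simp: le_Suc_eq numeral_2_eq_2)
      then show "b p = c p"
        using leak first same by cases (auto simp: cycle_param_eq)
    qed (use b c in \<open>simp_all add: U_def\<close>)
  qed
  ultimately show ?thesis by blast
qed

text \<open>The points to avoid lie on finitely many hyperplanes, where some parameter with index in
  \<open>{2..n}\<close> is zero or two of them agree. Each is null because varying one parameter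
  meets it at a single value.\<close>

lemma generically_locally_identifiable_cycle:
  assumes n: "n \<ge> 3"
  shows "generically_locally_identifiable (cycle_model n)"
proof -
  let ?P = "params (cycle_model n)"
  let ?M = "PiM ?P (\<lambda>_. lborel :: real measure)"
  have fin: "finite ?P"
    using n by (simp add: card_params_cycle)
  have mem: "cycle_index n i \<in> ?P" if "i \<in> {2..n}" for i
    using that n by (auto simp: params_cycle)
  have meas: "(\<lambda>a. cycle_param n a i) \<in> borel_measurable ?M" if "i \<in> {2..n}" for i
    unfolding cycle_param_eq
    using measurable_component_singleton[OF mem[OF that], of "\<lambda>_. lborel :: real measure"] by simp
  have null: "AE t in lborel. t \<noteq> (c :: real)" for c
    using AE_lborel_singleton .
  have "AE a in ?M. cycle_param n a i \<noteq> 0" if i: "i \<in> {2..n}" for i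
  proof (rule AE_PiM_lborel_fun_upd[OF fin mem[OF i]])
    show "{a \<in> space ?M. cycle_param n a i \<noteq> 0} \<in> sets ?M"
      using meas[OF i] by simp
  qed (simp add: cycle_param_eq null)
  then have nz: "AE a in ?M. \<forall>i\<in>{2..n}. cycle_param n a i \<noteq> 0"
    by (intro AE_finite_allI) auto
  have "AE a in ?M. i \<noteq> j \<longrightarrow> cycle_param n a i \<noteq> cycle_param n a j"
    if i: "i \<in> {2..n}" and j: "j \<in> {2..n}" for i j
  proof (cases "i = j")
    case False
    have "AE a in ?M. cycle_param n a i \<noteq> cycle_param n a j"
    proof (rule AE_PiM_lborel_fun_upd[OF fin mem[OF i]])
      show "{a \<in> space ?M. cycle_param n a i \<noteq> cycle_param n a j} \<in> sets ?M"
        using meas[OF i] meas[OF j] by (rule borel_measurable_neq)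
    qed (use False in \<open>simp add: cycle_param_eq null\<close>)
    then show ?thesis by simp
  qed simp
  then have "AE a in ?M. \<forall>i\<in>{2..n}. \<forall>j\<in>{2..n}. i \<noteq> j \<longrightarrow> cycle_param n a i \<noteq> cycle_param n a j"
    by (intro AE_finite_allI) auto
  with nz AE_space show ?thesis
    unfolding generically_locally_identifiable_def
  proof eventually_elim
    case (elim a)
    then show ?case
      by (intro cycle_locally_injective[OF n])
        (auto simp: space_PiM param_space_def inj_on_def)
  qed
qed

section \<open>The Jacobian determinant of the restricted map\<close>

text \<open>The indices decrease so that the Vandermonde product gets the sign of the theorem.\<close>

definition cycle_order :: "nat \<Rightarrow> (nat \<times> nat) list" where
  "cycle_order n = (0, 1) # cycle_index n 1 # map (\<lambda>i. cycle_index n (n - i)) [0..<n - 1]"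

lemma
  assumes n: "n \<ge> 3"
  shows length_cycle_order: "length (cycle_order n) = n + 1"
    and set_cycle_order: "set (cycle_order n) = params (cycle_model n)"
    and distinct_cycle_order: "distinct (cycle_order n)"
proof -
  show 1: "length (cycle_order n) = n + 1"
    using n by (simp add: cycle_order_def)
  have "(\<lambda>i. n - i) ` {0..<n - 1} = {2..n}"
  proof
    show "{2..n} \<subseteq> (\<lambda>i. n - i) ` {0..<n - 1}"
    proof
      fix i assume "i \<in> {2..n}"
      then show "i \<in> (\<lambda>i. n - i) ` {0..<n - 1}"
        by (intro image_eqI[of _ _ "n - i"]) auto
    qed
  qed auto
  then have "set (cycle_order n) = insert (0, 1) (insert (cycle_index n 1) (cycle_index n ` {2..n}))"
    by (simp add: cycle_order_def flip: image_image)
  also have "insert (cycle_index n 1) (cycle_index n ` {2..n}) = cycle_index n ` {1..n}"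
  proof -
    have "{1..n} = insert 1 {2..n}" using n by auto
    then show ?thesis by simp
  qed
  finally show 2: "set (cycle_order n) = params (cycle_model n)"
    using n by (simp add: params_cycle)
  show "distinct (cycle_order n)"
    using 1 2 card_params_cycle(2)[of n] n by (intro card_distinct) simp
qed

text \<open>The \<open>d\<close> coefficients do not depend on the leak and the first edge
  parameter, whose columns come first, so the lower left block is zero. The lower right block is the
  matrix of \<open>det_prod_linear_omit\<close>.\<close>

lemma det_jacobian_cycle_order:
  assumes n: "n \<ge> 3"
  shows "det (jacobian (length (chosen_coeffs n)) (cycle_order n)
      (restricted_coeff_map (cycle_model n) (chosen_coeffs n)) a) =
    (\<Prod>i = 2..n. cycle_param n a i) *
    (\<Prod>(i, j) \<in> {(i, j). 2 \<le> i \<and> i < j \<and> j \<le> n}. cycle_param n a i - cycle_param n a j)"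
proof -
  let ?D = "leaving_poly n a"
  let ?J = "mat (n + 1) (n + 1)
    (\<lambda>(k, j). coeff_partial n a (chosen_coeffs n ! k) (cycle_order n ! j))"
  define N where "N = n - 1"
  have N: "n = Suc N" "N \<ge> 2" using n by (auto simp: N_def)
  \<comment> \<open>Reversed numbering, as in \<open>cycle_order\<close>: for \<open>i < j\<close>
    the factor \<open>y j - y i\<close> has the smaller compartment first.\<close>
  define y where "y i = cycle_param n a (n - i)" for i
  define A1 where "A1 = mat 2 2 (\<lambda>(k, j). coeff_partial n a (chosen_coeffs n ! k) (cycle_order n ! j))"
  define A2 where "A2 = mat 2 N (\<lambda>(k, j). coeff_partial n a (chosen_coeffs n ! k) (cycle_order n ! (j + 2)))"
  define A4 where "A4 = mat N N (\<lambda>(k, i). coeff (\<Prod>j\<in>{..<N} - {i}. [:y j, 1:]) k)"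
  have row: "chosen_coeffs n ! 0 = 0" "chosen_coeffs n ! Suc 0 = n - 1"
    "k < N \<Longrightarrow> chosen_coeffs n ! Suc (Suc k) = n + k" for k
    using n by (simp_all add: chosen_coeffs_def N_def)
  have column: "cycle_order n ! 0 = (0, Suc 0)" "cycle_order n ! Suc 0 = cycle_index n (Suc 0)"
    "i < N \<Longrightarrow> cycle_order n ! Suc (Suc i) = cycle_index n (n - i)" for i
    using n by (simp_all add: cycle_order_def N_def)
  have const: "leaving_poly_deriv n a (0, Suc 0) = 0" "leaving_poly_deriv n a (cycle_index n (Suc 0)) = 0"
    by (auto simp: leaving_poly_deriv_def)
  have dD: "leaving_poly_deriv n a (cycle_index n (n - i)) = (\<Prod>j\<in>{..<N} - {i}. [:y j, 1:])"
    if "i < N" for i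
    using that N
    by (subst leaving_poly_deriv_index)
      (auto simp: y_def intro!: prod.reindex_bij_witness[of _ "\<lambda>j. n - j" "\<lambda>j. n - j"])
  have "?J = four_block_mat A1 A2 (0\<^sub>m N 2) A4"
  proof (rule eq_matI)
    fix k j assume "k < dim_row (four_block_mat A1 A2 (0\<^sub>m N 2) A4)"
      "j < dim_col (four_block_mat A1 A2 (0\<^sub>m N 2) A4)"
    then have kj: "k < N + 2" "j < N + 2" by (auto simp: A1_def A4_def)
    then have kn: "k < n + 1" "j < n + 1" using N by simp_all
    show "?J $$ (k, j) = four_block_mat A1 A2 (0\<^sub>m N 2) A4 $$ (k, j)"
    proof (cases "k < 2")
      case True
      show ?thesis
      proof (cases "j < 2")
        case False
        then have "Suc (Suc (j - 2)) = j" by simp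
        then show ?thesis using True False kj kn
          by (simp add: A1_def A2_def A4_def)
      qed (use True kj kn in \<open>simp add: A1_def A4_def\<close>)
    next
      case False
      then obtain k' where k': "k = Suc (Suc k')" "k' < N"
        using kj by (metis Suc_diff_Suc add_2_eq_Suc' less_2_cases_iff not0_implies_Suc Suc_less_eq One_nat_def)
      show ?thesis
      proof (cases "j < 2")
        case True
        then have "j = 0 \<or> j = Suc 0" by auto
        then show ?thesis using k' kj kn n
          by (auto simp: A1_def A4_def row column coeff_partial_def const)
      next
        case False
        then obtain j' where j': "j = Suc (Suc j')" "j' < N"
          using kj by (metis Suc_diff_Suc add_2_eq_Suc' less_2_cases_iff not0_implies_Suc Suc_less_eq One_nat_def)
        then show ?thesis using k' kj kn n
          by (simp add: A1_def A4_def row column coeff_partial_def dD)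
      qed
    qed
  qed (use N in \<open>auto simp: A1_def A4_def\<close>)
  then have "det ?J = det A1 * det A4"
    by (simp add: det_four_block_mat_lower_left_zero[of _ 2 _ N] A1_def A2_def A4_def)
  also have "det A1 = (\<Prod>i = 2..n. cycle_param n a i)"
  proof -
    \<comment> \<open>\<open>c_0\<close> does not involve the first edge parameter, so
      \<open>A1\<close> is lower triangular; its diagonal is \<open>d_0\<close> and the leading
      coefficient of \<open>D\<close>.\<close>
    have "det A1 = coeff ?D 0 * coeff ?D (n - 1)"
    proof (subst det_lower_triangular[of 2])
      show "A1 $$ (i, j) = 0" if "i < j" "j < 2" for i j
      proof -
        have "i = 0" "j = Suc 0" using that by auto
        then show ?thesis by (simp add: A1_def row column coeff_partial_def const)
      qed
      show "prod_list (diag_mat A1) = coeff ?D 0 * coeff ?D (n - 1)"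
        using n by (simp add: diag_mat_def A1_def row column coeff_partial_def const numeral_2_eq_2)
    qed (simp add: A1_def)
    then show ?thesis
      using coeff_leaving_poly_top(1)[OF n, of a]
      by (simp add: leaving_poly_def poly_prod flip: poly_0_coeff_0)
  qed
  also have "det A4 = (\<Prod>(i, j) \<in> {(i, j). 2 \<le> i \<and> i < j \<and> j \<le> n}. cycle_param n a i - cycle_param n a j)"
  proof -
    have "det A4 = (\<Prod>j<N. \<Prod>i<j. y j - y i)"
      unfolding A4_def by (rule det_prod_linear_omit)
    also have "\<dots> = (\<Prod>(j, i)\<in>(SIGMA j:{..<N}. {..<j}). y j - y i)"
      by (rule prod.Sigma) auto
    also have "\<dots> = (\<Prod>(i, j) \<in> {(i, j). 2 \<le> i \<and> i < j \<and> j \<le> n}. cycle_param n a i - cycle_param n a j)"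
      using N by (intro prod.reindex_bij_witness[of _ "\<lambda>(i, j). (n - i, n - j)" "\<lambda>(i, j). (n - i, n - j)"])
        (auto simp: y_def)
    finally show ?thesis .
  qed
  finally show ?thesis
    unfolding jacobian_restricted_cycle[OF n] length_cycle_order[OF n] .
qed

text \<open>Reordering the parameters permutes the columns. The permutation depends only on the two
  lists, so the sign is the same at every point \<open>a\<close>.\<close>

lemma det_jacobian_reorder:
  assumes ps: "distinct ps" "distinct qs" "set ps = set qs" and len: "length qs = m"
  shows "\<exists>s\<in>{1, -1}. \<forall>a. det (jacobian m ps F a) = s * det (jacobian m qs F a)"
proof -
  have "mset ps = mset qs"
    using ps by (simp add: set_eq_iff_mset_eq_distinct)
  then obtain p where p: "p permutes {..<length qs}" "permute_list p qs = ps"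
    by (rule mset_eq_permutation)
  have nth: "ps ! j = qs ! p j" if "j < m" for j
    using permute_list_nth[OF p(1)] p(2) that len by simp
  have lenps: "length ps = m"
    using p(2) len by auto
  have "det (jacobian m ps F a) = signof p * det (jacobian m qs F a)" for a
  proof -
    have "jacobian m ps F a = mat m m (\<lambda>(i, j). jacobian m qs F a $$ (i, p j))"
      using permutes_in_image[OF p(1)] len lenps
      by (intro eq_matI) (auto simp: jacobian_def nth)
    then show ?thesis
      using det_columns_permuted[of "jacobian m qs F a" m p] p(1) len
      by (simp add: jacobian_def atLeast0LessThan)
  qed
  moreover have "(signof p :: real) \<in> {1, -1}"
    by (simp add: sign_def)
  ultimately show ?thesis by blast
qed

theorem theorem5p3:
  fixes n :: nat
  assumes "n \<ge> 3"
  shows "generically_locally_identifiable (cycle_model n) \<and>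
    singular_locus_equation (cycle_model n)
      (\<lambda>a. (\<Prod>i = 2..n. cycle_param n a i) *
           (\<Prod>(i, j) \<in> {(i, j). 2 \<le> i \<and> i < j \<and> j \<le> n}.
              cycle_param n a i - cycle_param n a j))"
proof
  show "generically_locally_identifiable (cycle_model n)"
    using assms by (rule generically_locally_identifiable_cycle)
  let ?r = "restricted_coeff_map (cycle_model n) (chosen_coeffs n)"
  have card: "card (params (cycle_model n)) = n + 1"
    using assms by (simp add: card_params_cycle)
  have len: "length (chosen_coeffs n) = n + 1"
    using assms by (simp add: chosen_coeffs_def)
  have "distinct (chosen_coeffs n)" "set (chosen_coeffs n) \<subseteq> {..<num_coeffs (cycle_model n)}"
    using assms by (auto simp: chosen_coeffs_def num_coeffs_cycle)
  moreover have "(det (jacobian (length (chosen_coeffs n)) ps ?r a) = 0 \<longleftrightarrow>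
      vec_space.rank (num_coeffs (cycle_model n))
        (jacobian (num_coeffs (cycle_model n)) ps (coeff_map (cycle_model n)) a)
      < card (params (cycle_model n)))"
    if "distinct ps" "set ps = params (cycle_model n)" for ps a
    unfolding card using that card assms by (intro cycle_rank_iff) (simp_all flip: distinct_card)
  moreover have "\<exists>s\<in>{1, -1}. \<forall>a\<in>param_space (cycle_model n).
      det (jacobian (length (chosen_coeffs n)) ps ?r a) =
      s * ((\<Prod>i = 2..n. cycle_param n a i) *
           (\<Prod>(i, j) \<in> {(i, j). 2 \<le> i \<and> i < j \<and> j \<le> n}.
              cycle_param n a i - cycle_param n a j))"
    if ps: "distinct ps" "set ps = params (cycle_model n)" for ps
  proof -
    obtain s where s: "s \<in> {1, -1}"
      "det (jacobian (n + 1) ps ?r a) = s * det (jacobian (n + 1) (cycle_order n) ?r a)" for a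
      using det_jacobian_reorder[OF ps(1) distinct_cycle_order[OF assms] _ length_cycle_order[OF assms]]
        ps(2) set_cycle_order[OF assms] by metis
    then show ?thesis
      using det_jacobian_cycle_order[OF assms] unfolding len by auto
  qed
  ultimately show "singular_locus_equation (cycle_model n)
      (\<lambda>a. (\<Prod>i = 2..n. cycle_param n a i) *
           (\<Prod>(i, j) \<in> {(i, j). 2 \<le> i \<and> i < j \<and> j \<le> n}.
              cycle_param n a i - cycle_param n a j))"
    unfolding singular_locus_equation_def
    using len card by (intro exI[of _ "chosen_coeffs n"]) simp
qed

end
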